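(* Let $\mathcal I$ be an ideal on $\omega$. If $L$ is a compact subset of $c_{0,\mathcal I}$, then $$\inf_{A\in\mathcal I}\ \sup_{x\in L}q_A(x)=0.$$ Equivalently, the decreasing net $(q_A|_L)_{A\in(\mathcal I,\subseteq)}$ converges uniformly to zero on $L$.
   Context: An ideal on $\omega$ is a collection of subsets of $\omega$ containing $\emptyset$, closed under subsets and finite unions; every ideal is assumed to contain all finite sets. $c_{0,\mathcal I}$ is the closed subspace of $\ell_\infty$ (sup norm) of all bounded scalar sequences $(x_n)$ with $\{n:|x_n|\ge\varepsilon\}\in\mathcal I$ for every $\varepsilon>0$. For $A\in\mathcal I$, $q_A\colon c_{0,\mathcal I}\to\mathbb R$ is defined by $q_A(x)=\sup_{n\notin A}|x_n|$. Suprema of empty sets of nonnegative reals are taken to be $0$. The index set $\mathcal I$ is directed by inclusion. *)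

theory Defs
  imports "HOL-Analysis.Analysis"
begin

text \<open>Ideals contain all finite sets; the improper ideal \<^term>\<open>UNIV :: nat set set\<close> is not excluded.\<close>

definition ideal_on_omega :: "nat set set \<Rightarrow> bool" where
  "ideal_on_omega I \<longleftrightarrow>
     {} \<in> I \<and>
     (\<forall>A\<in>I. \<forall>B. B \<subseteq> A \<longrightarrow> B \<in> I) \<and>
     (\<forall>A\<in>I. \<forall>B\<in>I. A \<union> B \<in> I) \<and>
     (\<forall>A. finite A \<longrightarrow> A \<in> I)"

text \<open>Since the topology of \<^typ>\<open>nat\<close> is discrete, the type of bounded continuous functions on
  \<^typ>\<open>nat\<close> is the space of all bounded sequences with the supremum norm. The class
  \<^class>\<open>real_normed_field\<close> covers both real and complex scalars.\<close>

definition c0_ideal :: "nat set set \<Rightarrow> (nat \<Rightarrow>\<^sub>C 'a::real_normed_field) set" where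
  "c0_ideal I = {x. \<forall>\<epsilon>>0. {n. norm (apply_bcontfun x n) \<ge> \<epsilon>} \<in> I}"

text \<open>Supremum of a set of nonnegative reals, with value 0 on the empty set (where the
  library's \<^const>\<open>Sup\<close> on \<^typ>\<open>real\<close> is unspecified).\<close>

definition sup0 :: "real set \<Rightarrow> real" where
  "sup0 S = (if S = {} then 0 else Sup S)"

definition q :: "nat set \<Rightarrow> (nat \<Rightarrow>\<^sub>C 'a::real_normed_field) \<Rightarrow> real" where
  "q A x = sup0 ((\<lambda>n. norm (apply_bcontfun x n)) ` (- A))"

text \<open>The filter of tails of the directed set \<open>(I, \<subseteq>)\<close>: a net indexed by \<open>I\<close> converges iff it
  converges along this filter.\<close>

definition ideal_at_top :: "nat set set \<Rightarrow> nat set filter" where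
  "ideal_at_top I = (INF A\<in>I. principal {B \<in> I. A \<subseteq> B})"

lemma eventually_ideal_at_top:
  assumes "ideal_on_omega I"
  shows "eventually P (ideal_at_top I) \<longleftrightarrow> (\<exists>A\<in>I. \<forall>B\<in>I. A \<subseteq> B \<longrightarrow> P B)"
proof -
  have "I \<noteq> {}"
    using assms by (auto simp: ideal_on_omega_def)
  moreover have "\<exists>C\<in>I. principal {D \<in> I. C \<subseteq> D}
      \<le> inf (principal {D \<in> I. A \<subseteq> D}) (principal {D \<in> I. B \<subseteq> D})"
    if "A \<in> I" "B \<in> I" for A B
    using assms that by (intro bexI[of _ "A \<union> B"]) (auto simp: ideal_on_omega_def)
  ultimately have "eventually P (ideal_at_top I) \<longleftrightarrow>
      (\<exists>A\<in>I. eventually P (principal {B \<in> I. A \<subseteq> B}))"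
    unfolding ideal_at_top_def by (rule eventually_INF_base)
  then show ?thesis
    unfolding eventually_principal by blast
qed

end

theory Submission
  imports Defs
begin

text \<open>A compact set has a finite \<open>\<epsilon>/2\<close>-net. The finitely many sets
  \<open>{n. \<bar>y\<^sub>n\<bar> \<ge> \<epsilon>/2}\<close>, for \<open>y\<close> in the net, have their union \<open>A\<close> in the ideal, and off \<open>A\<close> every
  element of the compact set is smaller than \<open>\<epsilon>\<close>.\<close>

text \<open>The condition \<open>0 \<le> c\<close> handles the empty set, on which
  \<open>sup0\<close> is 0; otherwise this is the least upper bound property of
  \<open>Sup\<close>.\<close>

lemma sup0_least:
  assumes "\<And>s. s \<in> S \<Longrightarrow> s \<le> c" and "0 \<le> c"
  shows "sup0 S \<le> c"
  using assms by (auto simp: sup0_def intro: cSup_least)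

lemma sup0_upper:
  assumes "s \<in> S" and "bdd_above S"
  shows "s \<le> sup0 S"
  using assms by (auto simp: sup0_def intro: cSup_upper)

lemma sup0_nonneg:
  assumes "\<And>s. s \<in> S \<Longrightarrow> 0 \<le> s" and "bdd_above S"
  shows "0 \<le> sup0 S"
proof (cases "S = {}")
  case False
  then obtain s where "s \<in> S" by blast
  with assms sup0_upper[of s S] show ?thesis by force
qed (simp add: sup0_def)

lemma bdd_above_norm_bcontfun:
  "bdd_above ((\<lambda>n. norm (apply_bcontfun x n)) ` S)"
  by (rule bdd_aboveI[of _ "norm x"]) (auto simp: norm_bounded)

lemma q_nonneg: "0 \<le> q A x"
  unfolding q_def by (rule sup0_nonneg) (auto simp: bdd_above_norm_bcontfun)

lemma q_least:
  assumes "\<And>n. n \<notin> A \<Longrightarrow> norm (apply_bcontfun x n) \<le> c" and "0 \<le> c"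
  shows "q A x \<le> c"
  unfolding q_def using assms by (intro sup0_least) auto

lemma norm_le_q:
  assumes "n \<notin> A"
  shows "norm (apply_bcontfun x n) \<le> q A x"
  unfolding q_def using assms by (intro sup0_upper bdd_above_norm_bcontfun) auto

lemma q_antimono:
  assumes "A \<subseteq> B"
  shows "q B x \<le> q A x"
  \<comment> \<open>Every index outside \<open>B\<close> is outside \<open>A\<close>, so
    \<open>q A x\<close> bounds its term; \<open>q_nonneg\<close> settles the case
    \<open>B = UNIV\<close>, where no index is left.\<close>
  using assms by (intro q_least norm_le_q q_nonneg) auto

lemma q_le_norm: "q A x \<le> norm x"
  by (rule q_least) (auto simp: norm_bounded)

lemma ideal_on_omega_UN:
  assumes "ideal_on_omega I" and "finite K" and "\<And>k. k \<in> K \<Longrightarrow> F k \<in> I"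
  shows "(\<Union>k\<in>K. F k) \<in> I"
  using assms(2,3)
proof (induction K rule: finite_induct)
  case empty
  then show ?case using assms(1) by (simp add: ideal_on_omega_def)
next
  case (insert k K)
  then show ?case using assms(1) by (simp add: ideal_on_omega_def)
qed

lemma compact_c0_ideal_uniformly_small:
  fixes L :: "(nat \<Rightarrow>\<^sub>C 'a::real_normed_field) set"
  assumes I: "ideal_on_omega I" and "compact L" and L: "L \<subseteq> c0_ideal I" and "0 < \<epsilon>"
  obtains A where "A \<in> I" and "\<And>x. x \<in> L \<Longrightarrow> q A x \<le> \<epsilon>"
proof -
  \<comment> \<open>The balls are centred at all points of \<open>L\<close>, so the finite subcover
    has its centres in \<open>L\<close> and hence in \<open>c0_ideal I\<close>.\<close>
  obtain K where K: "K \<subseteq> L" "finite K" "L \<subseteq> (\<Union>y\<in>K. ball y (\<epsilon>/2))"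
    by (rule compactE_image[OF \<open>compact L\<close>, of L "\<lambda>y. ball y (\<epsilon>/2)"]) (use \<open>0 < \<epsilon>\<close> in auto)
  define A where "A = (\<Union>y\<in>K. {n. norm (apply_bcontfun y n) \<ge> \<epsilon>/2})"
  have "A \<in> I"
    unfolding A_def
  proof (rule ideal_on_omega_UN[OF I K(2)])
    fix y assume "y \<in> K"
    then have "y \<in> c0_ideal I"
      using K L by blast
    then show "{n. norm (apply_bcontfun y n) \<ge> \<epsilon>/2} \<in> I"
      unfolding c0_ideal_def using half_gt_zero[OF \<open>0 < \<epsilon>\<close>] by blast
  qed
  moreover have "q A x \<le> \<epsilon>" if "x \<in> L" for x
  proof (rule q_least)
    fix n assume "n \<notin> A"
    obtain y where y: "y \<in> K" "dist y x < \<epsilon>/2"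
      using K(3) \<open>x \<in> L\<close> by auto
    have "norm (apply_bcontfun y n) < \<epsilon>/2"
      using \<open>n \<notin> A\<close> y(1) by (auto simp: A_def not_le)
    \<comment> \<open>The supremum distance dominates the distance of the values at each
      index.\<close>
    moreover have "norm (apply_bcontfun x n - apply_bcontfun y n) < \<epsilon>/2"
      using dist_bounded[of y n x] y(2) by (simp add: dist_norm norm_minus_commute)
    ultimately show "norm (apply_bcontfun x n) \<le> \<epsilon>"
      using norm_triangle_sub[of "apply_bcontfun x n" "apply_bcontfun y n"] by linarith
  qed (use \<open>0 < \<epsilon>\<close> in simp)
  ultimately show ?thesis using that by blast
qed

theorem theorem4p1:
  fixes I :: "nat set set" and L :: "(nat \<Rightarrow>\<^sub>C 'a::real_normed_field) set"
  assumes "ideal_on_omega I"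
    and "compact L" and "L \<subseteq> c0_ideal I"
  shows "(INF A\<in>I. sup0 (q A ` L)) = 0 \<and>
         (\<forall>A\<in>I. \<forall>B\<in>I. A \<subseteq> B \<longrightarrow> (\<forall>x\<in>L. q B x \<le> q A x)) \<and>
         uniform_limit L q (\<lambda>x. 0) (ideal_at_top I)"
proof (intro conjI ballI impI)
  have "I \<noteq> {}"
    using assms(1) by (auto simp: ideal_on_omega_def)
  obtain M where M: "\<And>x. x \<in> L \<Longrightarrow> norm x \<le> M"
    using compact_imp_bounded[OF assms(2)] by (auto simp: bounded_iff)
  have nonneg: "0 \<le> sup0 (q A ` L)" for A
  proof (rule sup0_nonneg)
    show "bdd_above (q A ` L)"
      by (rule bdd_aboveI[of _ M]) (use M q_le_norm order_trans in blast)
  qed (auto simp: q_nonneg)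
  show "(INF A\<in>I. sup0 (q A ` L)) = 0"
  proof (rule antisym)
    show "(INF A\<in>I. sup0 (q A ` L)) \<le> 0"
    proof (rule field_le_epsilon)
      fix e :: real assume "0 < e"
      then obtain A where A: "A \<in> I" "\<And>x. x \<in> L \<Longrightarrow> q A x \<le> e"
        using compact_c0_ideal_uniformly_small[OF assms] by metis
      have "sup0 (q A ` L) \<le> e"
        using A(2) \<open>0 < e\<close> by (intro sup0_least) auto
      \<comment> \<open>The reals are only conditionally complete: comparing the infimum with its
        member at \<open>A\<close> requires a lower bound of the whole family.\<close>
      moreover have "bdd_below ((\<lambda>A. sup0 (q A ` L)) ` I)"
        by (rule bdd_belowI[of _ 0]) (auto simp: nonneg)
      ultimately show "(INF A\<in>I. sup0 (q A ` L)) \<le> 0 + e"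
        using cINF_lower2[OF _ A(1)] by simp
    qed
    show "0 \<le> (INF A\<in>I. sup0 (q A ` L))"
      using \<open>I \<noteq> {}\<close> nonneg by (rule cINF_greatest)
  qed
next
  fix A B :: "nat set" and x :: "nat \<Rightarrow>\<^sub>C 'a" assume "A \<subseteq> B"
  then show "q B x \<le> q A x" by (rule q_antimono)
next
  show "uniform_limit L q (\<lambda>x. 0) (ideal_at_top I)"
  proof (rule uniform_limitI)
    fix e :: real assume "0 < e"
    \<comment> \<open>Halving turns the non-strict bound of
      \<open>compact_c0_ideal_uniformly_small\<close> into the strict one that uniform convergence
      demands.\<close>
    then have "0 < e/2" by simp
    then obtain A where A: "A \<in> I" "\<And>x. x \<in> L \<Longrightarrow> q A x \<le> e/2"
      using compact_c0_ideal_uniformly_small[OF assms] by metis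
    \<comment> \<open>Monotonicity carries the bound from the single set \<open>A\<close> to the
      whole tail of the net above it, uniformly in \<open>x\<close>.\<close>
    have "dist (q B x) 0 < e" if "A \<subseteq> B" "x \<in> L" for B x
      using q_antimono[OF that(1), of x] A(2)[OF that(2)] q_nonneg[of B x] \<open>0 < e\<close> by simp
    with A(1) show "\<forall>\<^sub>F A in ideal_at_top I. \<forall>x\<in>L. dist (q A x) 0 < e"
      unfolding eventually_ideal_at_top[OF assms(1)] by blast
  qed
qed

end
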